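(* For every tree $T$ and for every integer $k\ge 1$, $$\gamma_{1k}(T)\le \gamma(T)+\left\lceil \frac{\gamma(T)}{k}\right\rceil-1,$$ and this bound is tight.
   Context: All graphs are finite, undirected, simple and connected; a tree is a connected acyclic graph. A set $S$ of vertices of a graph $G$ is a dominating set if every vertex not in $S$ is adjacent to at least one vertex of $S$; the domination number $\gamma(G)$ is the minimum cardinality of a dominating set. For an integer $k\ge 1$, a $k$-quasiperfect dominating set of $G$ is a dominating set $S$ such that every vertex not in $S$ is adjacent to at most $k$ vertices of $S$; $\gamma_{1k}(G)$ is the minimum cardinality of such a set. *)

theory Defs
  imports Complex_Main "Graph_Theory.Digraph_Component"
begin

text \<open>
  A finite simple undirected graph is a \<^locale>\<open>graph\<close>: a finite symmetric digraph without
  loops and parallel arcs, so that each edge is a pair of opposite arcs.  The library's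
  \<^const>\<open>tree\<close> is unsuitable here, since it counts \<open>u, v, u\<close> (an edge
  traversed back and forth) as a cycle.  The undirected cycles are exactly the cycles of length
  at least 3.  Note that \<^const>\<open>connected\<close> excludes the graph without vertices.
\<close>

definition undirected_tree :: "('a, 'b) pre_digraph \<Rightarrow> bool" where
  "undirected_tree G \<longleftrightarrow>
     graph G \<and> connected G \<and> \<not> (\<exists>p. pre_digraph.cycle G p \<and> 3 \<le> length p)"

definition dominating_set :: "('a, 'b) pre_digraph \<Rightarrow> 'a set \<Rightarrow> bool" where
  "dominating_set G S \<longleftrightarrow>
     S \<subseteq> verts G \<and> (\<forall>v \<in> verts G - S. \<exists>u \<in> S. v \<rightarrow>\<^bsub>G\<^esub> u)"

definition domination_number :: "('a, 'b) pre_digraph \<Rightarrow> nat" where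
  "domination_number G = (LEAST n. \<exists>S. dominating_set G S \<and> card S = n)"

definition quasiperfect_dominating_set :: "nat \<Rightarrow> ('a, 'b) pre_digraph \<Rightarrow> 'a set \<Rightarrow> bool" where
  "quasiperfect_dominating_set k G S \<longleftrightarrow>
     dominating_set G S \<and> (\<forall>v \<in> verts G - S. card {u \<in> S. v \<rightarrow>\<^bsub>G\<^esub> u} \<le> k)"

definition quasiperfect_domination_number :: "nat \<Rightarrow> ('a, 'b) pre_digraph \<Rightarrow> nat" where
  "quasiperfect_domination_number k G =
     (LEAST n. \<exists>S. quasiperfect_dominating_set k G S \<and> card S = n)"

end

theory Submission
  imports Defs
begin

text \<open>Upper bound: enlarge a minimum dominating set by any vertex with more than k neighbours
  in the current set, until none is left; the result is k-quasiperfect. After m additions the set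
  induces at least (k+1)m edges. It also induces a forest on \<gamma>+m vertices, with at most
  \<gamma>+m-1 edges. Hence km < \<gamma>, that is, m is at most the ceiling of \<gamma>/k minus 1.
  The carriers are \<open>acyclic_card_adj_pairs\<close> and
  \<open>acyclic_quasiperfect_extension\<close>.

  Tightness: \<open>extremal_tree\<close> has n centres with k+1 private leaves each, and hubs
  joining the centres. The centres form a minimum dominating set. A k-quasiperfect set missing a
  centre would contain its k+1 leaves, which is too many neighbours for a vertex outside; so it
  contains all centres, and then every hub adjacent to k+1 of them. There are (n-1) div k such hubs,
  exactly the excess allowed by the bound.\<close>

section \<open>Walks as vertex lists\<close>

text \<open>\<open>cycle\<close> speaks of arc lists, while the arguments below compare vertices.
  This lemma turns a closed vertex list into a forbidden cycle;
  \<open>successively_awalk_verts\<close> reads the adjacencies off a given one.\<close>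

lemma (in wf_digraph) awalk_of_vertices:
  assumes "xs \<noteq> []" "successively (dominates G) xs" "set xs \<subseteq> verts G"
  shows "\<exists>p. awalk (hd xs) p (last xs) \<and> awalk_verts (hd xs) p = xs"
  using assms
proof (induction xs rule: induct_list012)
  case (2 x)
  then show ?case by (intro exI[of _ "[]"]) (simp add: awalk_Nil_iff)
next
  case (3 x y zs)
  then obtain p where p: "awalk y p (last (y # zs))" "awalk_verts y p = y # zs"
    by auto
  from 3 obtain e where "e \<in> arcs G" "tail G e = x" "head G e = y" by auto
  with p show ?case by (intro exI[of _ "e # p"]) (simp add: awalk_Cons_iff)
qed simp

lemma (in wf_digraph) successively_awalk_verts:
  "awalk u p v \<Longrightarrow> successively (dominates G) (awalk_verts u p)"
proof (induction p arbitrary: u)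
  case (Cons e p)
  then have "awalk (head G e) p v" by (simp add: awalk_Cons_iff)
  with Cons have "successively (dominates G) (awalk_verts (head G e) p)" "awhd (head G e) p = head G e"
    by auto
  moreover have "tail G e \<rightarrow> head G e"
    using Cons.prems by (simp add: awalk_Cons_iff in_arcs_imp_in_arcs_ends)
  ultimately show ?case
    by (cases "awalk_verts (head G e) p") auto
qed simp

lemma (in graph) adj_sym: "u \<rightarrow> v \<Longrightarrow> v \<rightarrow> u"
  by (rule arcs_ends_symmetric[OF sym_arcs])

section \<open>Edge count of forests\<close>

text \<open>Take the first vertex of a longest path inside \<open>S\<close>. All its neighbours in
  \<open>S\<close> lie on the path, since otherwise the path could be extended, and any neighbour
  but the second vertex would close a cycle.\<close>

lemma (in graph) acyclic_obtain_leaf: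
  assumes acyclic: "\<not> (\<exists>p. cycle p \<and> 3 \<le> length p)"
    and S: "S \<subseteq> verts G" "S \<noteq> {}"
  obtains x where "x \<in> S" "card {y \<in> S. x \<rightarrow> y} \<le> 1"
proof -
  have fin: "finite S" using S finite_subset[OF S(1)] by simp
  define P where "P xs \<longleftrightarrow> xs \<noteq> [] \<and> distinct xs \<and> set xs \<subseteq> S \<and> successively (dominates G) xs" for xs
  obtain s where "s \<in> S" using S by auto
  then have ex: "P [s]" by (simp add: P_def)
  have bound: "length xs < Suc (card S)" if "P xs" for xs
    using that distinct_card[of xs] card_mono[OF fin, of "set xs"] by (simp add: P_def)
  obtain xs where xs: "P xs" "\<And>ys. P ys \<Longrightarrow> length ys \<le> length xs"
    using ex_has_greatest_nat[of P "[s]" length "Suc (card S)"] ex bound by (metis less_imp_le_nat)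
  then obtain x zs where x: "xs = x # zs" unfolding P_def by (cases xs) auto
  have xS: "x \<in> S" using xs x by (simp add: P_def)
  have in_path: "y \<in> set zs" if "y \<in> S" "x \<rightarrow> y" for y
  proof (rule ccontr)
    assume "y \<notin> set zs"
    moreover have "y \<noteq> x" using that adj_not_same by auto
    moreover have "y \<rightarrow> x" using that adj_sym by auto
    ultimately have "P (y # xs)" using xs(1) that x by (auto simp: P_def)
    then show False using xs(2)[of "y # xs"] by simp
  qed
  have first: "y = hd zs" if y: "y \<in> S" "x \<rightarrow> y" for y
  proof (rule ccontr)
    assume neq: "y \<noteq> hd zs"
    from in_path[OF y] obtain as bs where zs: "zs = as @ y # bs" by (meson split_list)
    have as: "as \<noteq> []" using neq zs by auto
    \<comment> \<open>The initial segment of the path up to \<open>y\<close>, closed by the edge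
      from \<open>y\<close> to \<open>x\<close>. Its length is at least 3 because \<open>as\<close>
      is nonempty.\<close>
    define c where "c = y # x # as @ [y]"
    have adj: "y \<rightarrow> x" using y adj_sym by auto
    have "xs = (x # as @ [y]) @ bs" using x zs by simp
    then have "successively (dominates G) (x # as @ [y])"
      using xs(1) unfolding P_def by (simp only: successively_append_iff)
    then have "successively (dominates G) c" using adj by (simp add: c_def)
    moreover have "set c \<subseteq> verts G" using xs(1) x zs S unfolding P_def c_def by auto
    ultimately obtain p where p: "awalk y p y" "awalk_verts y p = c"
      using awalk_of_vertices[of c] by (auto simp: c_def)
    have "length c = Suc (length p)" using p length_awalk_verts by metis
    then have len: "3 \<le> length p" using as by (cases as) (auto simp: c_def)
    have "distinct (tl c)" using xs(1) x zs by (auto simp: c_def P_def)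
    with p len have "cycle p" unfolding cycle_def by (intro exI[of _ y]) auto
    with len acyclic show False by auto
  qed
  \<comment> \<open>If \<open>zs\<close> is empty, \<open>hd zs\<close> is arbitrary, but by
    \<open>in_path\<close> there is then no neighbour.\<close>
  have "{y \<in> S. x \<rightarrow> y} \<subseteq> {hd zs}" using first by auto
  then have "card {y \<in> S. x \<rightarrow> y} \<le> 1" using card_mono[of "{hd zs}"] by fastforce
  with xS that show ?thesis by blast
qed

text \<open>Ordered pairs count each edge inside \<open>S\<close> twice; hence the factors 2
  below.\<close>

abbreviation adj_pairs :: "('a, 'b) pre_digraph \<Rightarrow> 'a set \<Rightarrow> ('a \<times> 'a) set" where
  "adj_pairs G S \<equiv> {(u, v). u \<in> S \<and> v \<in> S \<and> u \<rightarrow>\<^bsub>G\<^esub> v}"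

lemma finite_adj_pairs: "finite S \<Longrightarrow> finite (adj_pairs G S)"
  by (rule finite_subset[of _ "S \<times> S"]) auto

lemma (in graph) card_adj_pairs_insert:
  assumes "finite S" "x \<notin> S"
  shows "card (adj_pairs G (insert x S)) = card (adj_pairs G S) + 2 * card {y \<in> S. x \<rightarrow> y}"
proof -
  let ?N = "{y \<in> S. x \<rightarrow> y}"
  have eq: "adj_pairs G (insert x S) = adj_pairs G S \<union> (Pair x ` ?N \<union> (\<lambda>y. (y, x)) ` ?N)"
    using adj_not_same adj_sym by auto
  have "card (Pair x ` ?N \<union> (\<lambda>y. (y, x)) ` ?N) = card (Pair x ` ?N) + card ((\<lambda>y. (y, x)) ` ?N)"
    using assms by (intro card_Un_disjoint) auto
  also have "\<dots> = 2 * card ?N" by (simp add: card_image inj_on_def)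
  finally show ?thesis
    unfolding eq using assms
    by (subst card_Un_disjoint) (auto simp: finite_adj_pairs)
qed

text \<open>Removing a vertex with at most one neighbour in \<open>S\<close> removes at most one
  edge, so induction bounds the number of edges by the number of vertices minus 1. The additive form
  avoids truncated subtraction.\<close>

lemma (in graph) acyclic_card_adj_pairs:
  assumes acyclic: "\<not> (\<exists>p. cycle p \<and> 3 \<le> length p)"
    and "S \<subseteq> verts G" "S \<noteq> {}"
  shows "card (adj_pairs G S) + 2 \<le> 2 * card S"
  using assms(2,3)
proof (induction "card S" arbitrary: S)
  case 0
  then show ?case using finite_subset[OF \<open>S \<subseteq> verts G\<close>] by auto
next
  case (Suc n)
  have fin: "finite S" using finite_subset[OF \<open>S \<subseteq> verts G\<close>] by auto
  obtain x where x: "x \<in> S" "card {y \<in> S. x \<rightarrow> y} \<le> 1"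
    using acyclic_obtain_leaf[OF acyclic Suc.prems] by blast
  define R where "R = S - {x}"
  have S: "S = insert x R" "x \<notin> R" "finite R" using x fin by (auto simp: R_def)
  have "{y \<in> R. x \<rightarrow> y} = {y \<in> S. x \<rightarrow> y}" using S adj_not_same by auto
  then have ins: "card (adj_pairs G S) \<le> card (adj_pairs G R) + 2"
    using card_adj_pairs_insert[OF S(3,2)] x S(1) by simp
  show ?case
  proof (cases "R = {}")
    case True
    then have "adj_pairs G S = {}" using S adj_not_same by auto
    then show ?thesis using S True by (simp only: card.empty) simp
  next
    case False
    then have "card (adj_pairs G R) + 2 \<le> 2 * card R"
      using Suc S by auto
    then show ?thesis using ins S by simp
  qed
qed

section \<open>The upper bound\<close>

text \<open>
  Vertices with more than \<open>k\<close> neighbours in the current set are added until there are none.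
  Each addition creates at least \<open>k + 1\<close> edges inside the set, but a forest on
  \<open>s\<close> vertices has at most \<open>s - 1\<close> edges, so few additions are possible.
\<close>

lemma (in graph) acyclic_quasiperfect_extension:
  assumes acyclic: "\<not> (\<exists>p. cycle p \<and> 3 \<le> length p)"
    and D: "dominating_set G D" "D \<noteq> {}"
  obtains S m where "quasiperfect_dominating_set k G S" "card S = card D + m" "k * m < card D"
proof -
  have DV: "D \<subseteq> verts G" using D by (simp add: dominating_set_def)
  \<comment> \<open>The invariant of the additions: k+1 edges, so 2(k+1) ordered pairs, per added
    vertex. A set of maximal size satisfying it replaces the iteration.\<close>
  define P where "P S \<longleftrightarrow> D \<subseteq> S \<and> S \<subseteq> verts G \<and>
    2 * Suc k * (card S - card D) \<le> card (adj_pairs G S)" for S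
  have "P D" using DV by (simp add: P_def)
  moreover have "card S < Suc (card (verts G))" if "P S" for S
    using that by (auto simp: P_def less_Suc_eq_le intro: card_mono)
  ultimately obtain S where S: "P S" "\<And>S'. P S' \<Longrightarrow> card S' \<le> card S"
    using ex_has_greatest_nat[of P D card "Suc (card (verts G))"] by (metis less_imp_le_nat)
  have fin: "finite S" using S(1) finite_subset[of S "verts G"] by (simp add: P_def)
  have DS: "D \<subseteq> S" "S \<subseteq> verts G" using S by (auto simp: P_def)
  have "card {u \<in> S. v \<rightarrow> u} \<le> k" if v: "v \<in> verts G - S" for v
  proof (rule ccontr)
    assume "\<not> card {u \<in> S. v \<rightarrow> u} \<le> k"
    then have "Suc k \<le> card {u \<in> S. v \<rightarrow> u}" by simp
    then have "card (adj_pairs G S) + 2 * Suc k \<le> card (adj_pairs G (insert v S))"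
      using card_adj_pairs_insert[OF fin, of v] v by simp
    moreover have "card (insert v S) - card D = Suc (card S - card D)"
      using v fin card_mono[OF fin DS(1)] by (simp add: Suc_diff_le)
    ultimately have "P (insert v S)"
      using S(1) v by (auto simp: P_def)
    then show False using S(2)[of "insert v S"] v fin by simp
  qed
  moreover have "dominating_set G S"
    using D DS unfolding dominating_set_def by blast
  ultimately have "quasiperfect_dominating_set k G S"
    by (simp add: quasiperfect_dominating_set_def)
  moreover obtain m where m: "card S = card D + m"
    using card_mono[OF fin DS(1)] le_Suc_ex by blast
  moreover have "k * m < card D"
  proof -
    have "S \<noteq> {}" using D DS by auto
    \<comment> \<open>The invariant below, the forest bound above; cancelling gives km + 1 \<le>
      \<open>card D\<close>.\<close>
    then have "2 * Suc k * m + 2 \<le> 2 * (card D + m)"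
      using acyclic_card_adj_pairs[OF acyclic DS(2)] D DS S(1) m by (auto simp: P_def)
    then show ?thesis by simp
  qed
  ultimately show thesis using that by blast
qed

lemma domination_number_attained:
  obtains S where "dominating_set G S" "card S = domination_number G"
proof -
  have "\<exists>S. dominating_set G S \<and> card S = card (verts G)"
    by (intro exI[of _ "verts G"]) (simp add: dominating_set_def)
  then have "\<exists>S. dominating_set G S \<and> card S = domination_number G"
    unfolding domination_number_def by (rule LeastI[where P = "\<lambda>n. \<exists>S. dominating_set G S \<and> card S = n"])
  then show ?thesis using that by blast
qed

lemma quasiperfect_domination_number_attained:
  obtains S where "quasiperfect_dominating_set k G S" "card S = quasiperfect_domination_number k G"
proof -
  have "\<exists>S. quasiperfect_dominating_set k G S \<and> card S = card (verts G)"
    by (intro exI[of _ "verts G"]) (simp add: dominating_set_def quasiperfect_dominating_set_def)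
  then have "\<exists>S. quasiperfect_dominating_set k G S \<and> card S = quasiperfect_domination_number k G"
    unfolding quasiperfect_domination_number_def
    by (rule LeastI[where P = "\<lambda>n. \<exists>S. quasiperfect_dominating_set k G S \<and> card S = n"])
  then show ?thesis using that by blast
qed

lemma domination_number_le: "dominating_set G S \<Longrightarrow> domination_number G \<le> card S"
  unfolding domination_number_def by (rule Least_le) auto

lemma quasiperfect_domination_number_le:
  "quasiperfect_dominating_set k G S \<Longrightarrow> quasiperfect_domination_number k G \<le> card S"
  unfolding quasiperfect_domination_number_def by (rule Least_le) auto

lemma tree_quasiperfect_domination_number_le:
  assumes "undirected_tree T" "k \<ge> 1"
  shows "int (quasiperfect_domination_number k T)
    \<le> int (domination_number T) + \<lceil>real (domination_number T) / real k\<rceil> - 1"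
proof -
  from assms interpret graph T by (simp add: undirected_tree_def)
  have ne: "verts T \<noteq> {}"
    using assms by (simp add: undirected_tree_def connected_def strongly_connected_def)
  obtain D where D: "dominating_set T D" "card D = domination_number T"
    by (rule domination_number_attained)
  have "D \<noteq> {}" using D ne by (auto simp: dominating_set_def)
  then obtain S m where S: "quasiperfect_dominating_set k T S" "card S = card D + m" "k * m < card D"
    using acyclic_quasiperfect_extension[of D k] assms D by (auto simp: undirected_tree_def)
  have "real k * real m < real (card D)" using S(3) by (metis of_nat_less_iff of_nat_mult)
  then have "real m < real (card D) / real k"
    using assms(2) by (simp add: pos_less_divide_eq mult.commute)
  then have "int m < \<lceil>real (card D) / real k\<rceil>" by (simp add: less_ceiling_iff)
  then show ?thesis
    using quasiperfect_domination_number_le[OF S(1)] S(2) unfolding D(2)[symmetric] by linarith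
qed

section \<open>Trees from parent functions\<close>

text \<open>Vertex 0 is the root; the guards on positivity make the value \<open>p 0\<close>
  irrelevant. Each edge appears in both orientations.\<close>

definition parent_graph :: "nat \<Rightarrow> (nat \<Rightarrow> nat) \<Rightarrow> (nat, nat \<times> nat) pre_digraph" where
  "parent_graph N p = \<lparr>verts = {..<N},
     arcs = {(u, v). u < N \<and> v < N \<and> (0 < v \<and> u = p v \<or> 0 < u \<and> v = p u)},
     tail = fst, head = snd\<rparr>"

lemma verts_parent_graph [simp]: "verts (parent_graph N p) = {..<N}"
  by (simp add: parent_graph_def)

lemma adj_parent_graph [simp]:
  "u \<rightarrow>\<^bsub>parent_graph N p\<^esub> v \<longleftrightarrow> u < N \<and> v < N \<and> (0 < v \<and> u = p v \<or> 0 < u \<and> v = p u)"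
  by (auto simp: parent_graph_def arcs_ends_conv)

lemma graph_parent_graph:
  assumes "\<And>v. 0 < v \<Longrightarrow> p v < v"
  shows "graph (parent_graph N p)"
proof unfold_locales
  have neq: "p v \<noteq> v" "v \<noteq> p v" if "0 < v" for v
    using assms[OF that] by auto
  have "arcs (parent_graph N p) \<subseteq> {..<N} \<times> {..<N}"
    by (auto simp: parent_graph_def)
  then show "finite (arcs (parent_graph N p))"
    using finite_subset by blast
  show "symmetric (parent_graph N p)"
    unfolding symmetric_def by (rule symI) auto
  show "tail (parent_graph N p) e \<noteq> head (parent_graph N p) e" if "e \<in> arcs (parent_graph N p)" for e
    using that neq by (auto simp: parent_graph_def)
qed (auto simp: parent_graph_def arc_to_ends_def)

text \<open>
  The largest vertex of a cycle would have its parent as both predecessor and successor.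
\<close>

lemma undirected_tree_parent_graph:
  assumes p: "\<And>v. 0 < v \<Longrightarrow> p v < v" and N: "0 < N"
  shows "undirected_tree (parent_graph N p)"
proof -
  let ?G = "parent_graph N p"
  interpret graph ?G by (rule graph_parent_graph[OF p])
  have root: "v \<rightarrow>\<^sup>*\<^bsub>?G\<^esub> 0" if "v < N" for v
    using that
  proof (induction v rule: less_induct)
    case (less v)
    show ?case
    proof (cases "v = 0")
      case False
      then have "v \<rightarrow>\<^bsub>?G\<^esub> p v" using p[of v] less.prems by simp
      moreover have "p v \<rightarrow>\<^sup>*\<^bsub>?G\<^esub> 0" using less False p[of v] by simp
      ultimately show ?thesis by (rule adj_reachable_trans)
    qed (use N in auto)
  qed
  have "u \<rightarrow>\<^sup>*\<^bsub>?G\<^esub> v" if "u < N" "v < N" for u v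
    using root[OF that(1)] symmetric_reachable'[OF root[OF that(2)]] by (rule reachable_trans)
  then have "connected ?G"
    using N by (auto simp: connected_def strongly_connected_def reachable_mk_symmetric_eq[OF sym_arcs])
  moreover have False if "cycle q" "3 \<le> length q" for q
  proof -
    from that obtain r where r: "awalk r q r" "distinct (tl (awalk_verts r q))"
      unfolding cycle_def by blast
    define w l where "w = (!) (awalk_verts r q)" and "l = length q"
    have len: "length (awalk_verts r q) = Suc l" by (simp add: l_def length_awalk_verts)
    have ends: "w 0 = w l"
      using r(1) len hd_conv_nth[of "awalk_verts r q"] last_conv_nth[of "awalk_verts r q"]
      by (auto simp: w_def)
    have adj: "w i \<rightarrow>\<^bsub>?G\<^esub> w (Suc i)" if "i < l" for i
      using successively_nth[OF successively_awalk_verts[OF r(1)], of i] that len by (simp add: w_def)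
    \<comment> \<open>Indices 1 to \<open>l\<close> list each vertex of the cycle once; index 0
      repeats \<open>l\<close>.\<close>
    have inj: "i = j" if "w i = w j" "0 < i" "i \<le> l" "0 < j" "j \<le> l" for i j
      using nth_eq_iff_index_eq[OF r(2), of "i - 1" "j - 1"] that len
      by (cases i; cases j) (auto simp: w_def nth_tl)
    have l: "3 \<le> l" using that(2) by (simp add: l_def)
    obtain j where j: "j \<in> {1..l}" "\<And>i. i \<in> {1..l} \<Longrightarrow> w i \<le> w j"
    proof -
      have "Max (w ` {1..l}) \<in> w ` {1..l}" using l by (intro Max_in) auto
      then obtain j where "j \<in> {1..l}" "Max (w ` {1..l}) = w j" by auto
      then show thesis using that[of j] Max_ge[of "w ` {1..l}"] by (metis finite_atLeastAtMost finite_imageI imageI)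
    qed
    \<comment> \<open>Cyclic successor of \<open>j\<close> within 1 to \<open>l\<close>;
      \<open>h\<close> below is the cyclic predecessor. They differ because the cycle has length at
      least 3.\<close>
    define i where "i = (if j = l then 1 else Suc j)"
    have "w j \<rightarrow>\<^bsub>?G\<^esub> w i"
      using adj[of j] adj[of 0] ends j(1) l by (auto simp: i_def)
    moreover have "w i \<le> w j" using j l by (auto simp: i_def)
    ultimately have i: "w i = p (w j)" using p[of "w i"] by auto
    define h where "h = (if j = 1 then l else j - 1)"
    have "w h \<rightarrow>\<^bsub>?G\<^esub> w j"
      using adj[of "j - 1"] ends j(1) l by (auto simp: h_def)
    moreover have "w h \<le> w j" using j(1) l by (intro j(2)) (auto simp: h_def)
    ultimately have "w h = p (w j)" using p[of "w h"] by auto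
    with i have "w h = w i" by simp
    then have "h = i" by (rule inj) (use j(1) l in \<open>auto simp: h_def i_def\<close>)
    then show False using l j(1) by (auto simp: h_def i_def split: if_splits)
  qed
  ultimately show ?thesis
    using graph_axioms by (auto simp: undirected_tree_def)
qed

section \<open>The extremal trees\<close>

text \<open>
  With \<open>c = k + 3\<close>, the centres are the vertices \<open>c * i\<close> for \<open>i < n\<close>.  Centre \<open>i\<close> has the
  \<open>k + 1\<close> leaves \<open>c * i + 2, \<dots>, c * i + k + 2\<close>.  The vertices \<open>c * j + 1\<close> are all
  children of the centre \<open>0\<close>; the \<open>j\<close>-th of them is the parent of the centres
  \<open>k * j + 1, \<dots>, k * j + k\<close>, so that it is adjacent to \<open>k + 1\<close> centres when these all exist.
\<close>

definition extremal_parent :: "nat \<Rightarrow> nat \<Rightarrow> nat" where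
  "extremal_parent k v =
     (let c = k + 3 in
      if v mod c = 0 then c * ((v div c - 1) div k) + 1
      else if v mod c = 1 then 0 else c * (v div c))"

text \<open>Block i holds a centre (residue 0), a hub (residue 1) and k+1 leaves. Every block has a
  hub, but the later hubs may have fewer than k children.\<close>

definition extremal_tree :: "nat \<Rightarrow> nat \<Rightarrow> (nat, nat \<times> nat) pre_digraph" where
  "extremal_tree k n = parent_graph (n * (k + 3)) (extremal_parent k)"

lemma block_mod: "t < c \<Longrightarrow> (c * i + t) mod c = t"
  and block_div: "t < c \<Longrightarrow> (c * i + t) div c = i" for c :: nat
  by simp_all

lemma extremal_parent_simps:
  "extremal_parent k ((k + 3) * i) = (k + 3) * ((i - 1) div k) + 1"
  "extremal_parent k ((k + 3) * i + 1) = 0"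
  "2 \<le> t \<Longrightarrow> t < k + 3 \<Longrightarrow> extremal_parent k ((k + 3) * i + t) = (k + 3) * i"
  using block_mod[of 0 "k + 3" i] block_mod[of 1 "k + 3" i] block_mod[of t "k + 3" i]
  by (simp_all add: extremal_parent_def Let_def)

lemma extremal_parent_less:
  assumes "0 < v"
  shows "extremal_parent k v < v"
proof -
  define i t where "i = v div (k + 3)" and "t = v mod (k + 3)"
  have v: "v = (k + 3) * i + t" and t: "t < k + 3" by (auto simp: i_def t_def)
  consider "t = 0" | "t = 1" | "2 \<le> t" by linarith
  then show ?thesis
  proof cases
    case 1
    then obtain j where j: "i = Suc j" using v assms by (cases i) auto
    \<comment> \<open>The parent hub of centre j+1 lies in block j or earlier.\<close>
    have "(k + 3) * (j div k) + 1 \<le> (k + 3) * j + 1"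
      by (intro add_le_mono mult_le_mono2 div_le_dividend order_refl)
    also have "\<dots> < (k + 3) * i" by (simp add: j)
    finally show ?thesis using 1 v j extremal_parent_simps(1)[of k i] by simp
  next
    case 2
    then show ?thesis using v extremal_parent_simps(2)[of k i] by simp
  next
    case 3
    then show ?thesis using v t extremal_parent_simps(3)[of t k i] by simp
  qed
qed

lemma undirected_tree_extremal_tree: "n \<ge> 1 \<Longrightarrow> undirected_tree (extremal_tree k n)"
  unfolding extremal_tree_def
  by (rule undirected_tree_parent_graph) (auto intro: extremal_parent_less)

text \<open>Only centres and hubs are parents, so leaves have no children.\<close>

lemma extremal_parent_mod_le: "extremal_parent k v mod (k + 3) \<le> 1"
  using block_mod[of 1 "k + 3" "(v div (k + 3) - 1) div k"]
  by (simp add: extremal_parent_def Let_def)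

lemma block_less:
  assumes "i < n" "t < (c::nat)"
  shows "c * i + t < n * c"
proof -
  have "c * i + t < c * Suc i" using assms by simp
  also have "\<dots> \<le> c * n" using assms by (intro mult_le_mono2) simp
  finally show ?thesis by (simp add: mult.commute)
qed

lemma verts_extremal_tree [simp]: "verts (extremal_tree k n) = {..<n * (k + 3)}"
  by (simp add: extremal_tree_def)

lemma extremal_leaf_adj_iff:
  assumes "i < n" "2 \<le> t" "t < k + 3"
  shows "((k + 3) * i + t) \<rightarrow>\<^bsub>extremal_tree k n\<^esub> u \<longleftrightarrow> u = (k + 3) * i"
proof -
  have "(k + 3) * i + t \<noteq> extremal_parent k u" for u
  proof
    assume "(k + 3) * i + t = extremal_parent k u"
    then have "((k + 3) * i + t) mod (k + 3) \<le> 1" using extremal_parent_mod_le by metis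
    then show False using assms by (simp del: mult_Suc_right)
  qed
  then show ?thesis
    using assms block_less[of i n t "k + 3"] extremal_parent_simps(3)[of t k i]
    by (auto simp: extremal_tree_def)
qed

text \<open>A leaf outside \<open>D\<close> can only be dominated by its centre.\<close>

lemma extremal_dominating_block:
  assumes D: "dominating_set (extremal_tree k n) D" and i: "i < n"
  shows "(k + 3) * i \<in> D \<or> (\<forall>t \<in> {2..<k + 3}. (k + 3) * i + t \<in> D)"
proof -
  have "(k + 3) * i \<in> D" if t: "t \<in> {2..<k + 3}" "(k + 3) * i + t \<notin> D" for t
  proof -
    have "(k + 3) * i + t \<in> verts (extremal_tree k n) - D"
      using t i block_less[of i n t "k + 3"] by simp
    then obtain u where "u \<in> D" "((k + 3) * i + t) \<rightarrow>\<^bsub>extremal_tree k n\<^esub> u"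
      using D unfolding dominating_set_def by blast
    then show ?thesis using extremal_leaf_adj_iff[of i n t k u] i t by simp
  qed
  then show ?thesis by blast
qed

text \<open>The centres dominate: centre 0 sees every hub and each leaf has its own centre.
  Conversely, every dominating set meets each of the n blocks, in the centre or a leaf.\<close>

lemma domination_number_extremal_tree:
  assumes "n \<ge> 1"
  shows "domination_number (extremal_tree k n) = n"
proof (rule antisym)
  let ?X = "(\<lambda>i. (k + 3) * i) ` {..<n}"
  have "\<exists>u \<in> ?X. v \<rightarrow>\<^bsub>extremal_tree k n\<^esub> u" if v: "v \<in> verts (extremal_tree k n) - ?X" for v
  proof -
    define i t where "i = v div (k + 3)" and "t = v mod (k + 3)"
    have vi: "v = (k + 3) * i + t" and t: "t < k + 3" by (auto simp: i_def t_def)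
    have i: "i < n" using v by (simp add: i_def less_mult_imp_div_less)
    then have "t \<noteq> 0" using v vi by auto
    then consider "t = 1" | "2 \<le> t" by linarith
    then show ?thesis
    proof cases
      case 1
      then have "v \<rightarrow>\<^bsub>extremal_tree k n\<^esub> 0"
        using v vi extremal_parent_simps(2)[of k i] by (auto simp: extremal_tree_def)
      moreover have "0 \<in> ?X" using assms by force
      ultimately show ?thesis by blast
    next
      case 2
      then show ?thesis using extremal_leaf_adj_iff[OF i 2 t] vi i by auto
    qed
  qed
  moreover have "?X \<subseteq> verts (extremal_tree k n)"
    using block_less[of _ n 0 "k + 3"] by auto
  ultimately have "dominating_set (extremal_tree k n) ?X"
    unfolding dominating_set_def by blast
  then have "domination_number (extremal_tree k n) \<le> card ?X" by (rule domination_number_le)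
  also have "\<dots> \<le> n" using card_image_le[of "{..<n}"] by simp
  finally show "domination_number (extremal_tree k n) \<le> n" .
next
  obtain D where D: "dominating_set (extremal_tree k n) D" "card D = domination_number (extremal_tree k n)"
    by (rule domination_number_attained)
  then have fin: "finite D" using finite_subset[of D "{..<n * (k + 3)}"] by (simp add: dominating_set_def)
  have "i \<in> (\<lambda>v. v div (k + 3)) ` D" if "i < n" for i
  proof -
    have "(k + 3) * i \<in> D \<or> (k + 3) * i + 2 \<in> D"
      using extremal_dominating_block[OF D(1) that] by (rule disj_forward) (auto dest!: bspec[of _ _ 2])
    moreover have "((k + 3) * i) div (k + 3) = i" "((k + 3) * i + 2) div (k + 3) = i"
      by (simp, rule block_div, simp)
    ultimately show ?thesis by (metis image_eqI)
  qed
  then have "card {..<n} \<le> card ((\<lambda>v. v div (k + 3)) ` D)"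
    using fin by (intro card_mono) auto
  also have "\<dots> \<le> card D" using fin by (rule card_image_le)
  finally show "n \<le> domination_number (extremal_tree k n)" using D(2) by simp
qed

text \<open>
  A missing centre would have its \<open>k + 1\<close> leaves in the set, so all centres are present, and then
  so is every vertex adjacent to \<open>k + 1\<close> of them.
\<close>

lemma quasiperfect_domination_number_extremal_tree_ge:
  assumes k: "k \<ge> 1" and n: "n \<ge> 1"
  shows "n + (n - 1) div k \<le> quasiperfect_domination_number k (extremal_tree k n)"
proof -
  let ?T = "extremal_tree k n"
  let ?c = "k + 3"
  obtain S where S: "quasiperfect_dominating_set k ?T S" "card S = quasiperfect_domination_number k ?T"
    by (rule quasiperfect_domination_number_attained)
  have dom: "dominating_set ?T S" using S by (simp add: quasiperfect_dominating_set_def)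
  then have fin: "finite S" using finite_subset[of S "{..<n * ?c}"] by (simp add: dominating_set_def)
  have in_S: "v \<in> S" if "v < n * ?c" "A \<subseteq> S" "card A = Suc k" "\<And>u. u \<in> A \<Longrightarrow> v \<rightarrow>\<^bsub>?T\<^esub> u" for v A
  proof (rule ccontr)
    assume "v \<notin> S"
    then have "card {u \<in> S. v \<rightarrow>\<^bsub>?T\<^esub> u} \<le> k"
      using S(1) that(1) by (simp add: quasiperfect_dominating_set_def)
    moreover have "card A \<le> card {u \<in> S. v \<rightarrow>\<^bsub>?T\<^esub> u}"
      using fin that by (intro card_mono) auto
    ultimately show False using that(3) by simp
  qed
  have centre: "?c * i \<in> S" if i: "i < n" for i
  proof (rule ccontr)
    assume not: "?c * i \<notin> S"
    interpret graph ?T using undirected_tree_extremal_tree[OF n] by (simp add: undirected_tree_def)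
    have "?c * i \<in> S"
    proof (rule in_S[of _ "(\<lambda>t. ?c * i + t) ` {2..<?c}"])
      show "?c * i < n * ?c" using block_less[OF i, of 0 ?c] by simp
      show "(\<lambda>t. ?c * i + t) ` {2..<?c} \<subseteq> S" using extremal_dominating_block[OF dom i] not by blast
      show "card ((\<lambda>t. ?c * i + t) ` {2..<?c}) = Suc k" by (subst card_image) (auto simp: inj_on_def)
      show "(?c * i) \<rightarrow>\<^bsub>?T\<^esub> u" if "u \<in> (\<lambda>t. ?c * i + t) ` {2..<?c}" for u
      proof -
        obtain t where "u = ?c * i + t" "2 \<le> t" "t < ?c" using \<open>u \<in> _\<close> by (auto simp del: image_add_atLeastLessThan)
        then show ?thesis using extremal_leaf_adj_iff[OF i, of t k "?c * i"] adj_sym by simp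
      qed
    qed
    with not show False ..
  qed
  \<comment> \<open>The bound on \<open>j\<close> ensures that the k child centres of hub
    \<open>j\<close> all exist.\<close>
  have hub: "?c * j + 1 \<in> S" if j: "j < (n - 1) div k" for j
  proof -
    have kj: "k * j + k < n"
    proof -
      have "k * Suc j \<le> k * ((n - 1) div k)" using j by (intro mult_le_mono2) simp
      also have "\<dots> \<le> n - 1" by simp
      finally show ?thesis using n by simp
    qed
    have "1 * j \<le> k * j" using k by (intro mult_le_mono1) simp
    then have jn: "j < n" using kj by (simp only: mult_1)
    \<comment> \<open>Centre 0 is the parent of the hub, the other k indices are its
      children.\<close>
    let ?I = "insert 0 {k * j + 1..k * j + k}"
    show ?thesis
    proof (rule in_S[of _ "(\<lambda>i. ?c * i) ` ?I"])
      show less: "?c * j + 1 < n * ?c" by (rule block_less[OF jn]) simp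
      show "(\<lambda>i. ?c * i) ` ?I \<subseteq> S" using kj n by (intro image_subsetI centre) auto
      show "card ((\<lambda>i. ?c * i) ` ?I) = Suc k" by (subst card_image) (auto simp: inj_on_def)
      show "(?c * j + 1) \<rightarrow>\<^bsub>?T\<^esub> u" if "u \<in> (\<lambda>i. ?c * i) ` ?I" for u
      proof -
        obtain i where i: "u = ?c * i" "i \<in> ?I" using \<open>u \<in> _\<close> by auto
        show ?thesis
        proof (cases "i = 0")
          case True
          then show ?thesis using n i less extremal_parent_simps(2)[of k j] by (simp add: extremal_tree_def)
        next
          case False
          then have i1: "k * j + 1 \<le> i" "i \<le> k * j + k" using i by auto
          have "(i - 1) div k = j"
            using i1 k by (intro div_nat_eqI) (auto simp: mult.commute)
          then have "extremal_parent k u = ?c * j + 1"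
            using i extremal_parent_simps(1)[of k i] by simp
          moreover have "u < n * ?c" using block_less[of i n 0 ?c] i i1 kj by simp
          moreover have "0 < u" using i i1 by simp
          ultimately show ?thesis using less by (simp add: extremal_tree_def)
        qed
      qed
    qed
  qed
  let ?X = "(\<lambda>i. ?c * i) ` {..<n}" and ?W = "(\<lambda>j. ?c * j + 1) ` {..<(n - 1) div k}"
  have "?c * i \<noteq> ?c * j + 1" for i j
  proof
    assume "?c * i = ?c * j + 1"
    then have "(?c * i) mod ?c = (?c * j + 1) mod ?c" by (rule arg_cong)
    then show False using block_mod[of 1 ?c j] by simp
  qed
  then have "?X \<inter> ?W = {}" by blast
  then have "card (?X \<union> ?W) = card ?X + card ?W" by (intro card_Un_disjoint) auto
  also have "\<dots> = n + (n - 1) div k" by (simp add: card_image inj_on_def)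
  finally have "n + (n - 1) div k = card (?X \<union> ?W)" ..
  also have "\<dots> \<le> card S" using fin centre hub by (intro card_mono) auto
  finally show ?thesis using S(2) by simp
qed

text \<open>With q = (n-1) div k one has kq < n \<le> k(q+1). This matches the number of forced hubs
  with the excess in the upper bound.\<close>

lemma ceiling_divide_nat_eq:
  assumes "k \<ge> 1" "n \<ge> 1"
  shows "\<lceil>real n / real k\<rceil> = int ((n - 1) div k) + 1"
proof -
  define q where "q = (n - 1) div k"
  have "k * q \<le> n - 1" "n - 1 < k * q + k"
    using assms dividend_less_times_div[of k "n - 1"] by (auto simp: q_def)
  then have "k * q < n" "n \<le> k * (q + 1)" using assms by auto
  then have "real k * real q < real n" "real n \<le> real k * (real q + 1)"
    by (metis of_nat_less_iff of_nat_mult, metis of_nat_1 of_nat_add of_nat_le_iff of_nat_mult)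
  then have "real q < real n / real k" "real n / real k \<le> real q + 1"
    using assms by (auto simp: field_simps)
  then show ?thesis unfolding q_def[symmetric] by (intro ceiling_unique) auto
qed

theorem theorem2:
  fixes k :: nat
  assumes "k \<ge> 1"
  shows
    "(\<forall>T :: ('a, 'b) pre_digraph. undirected_tree T \<longrightarrow>
        int (quasiperfect_domination_number k T)
          \<le> int (domination_number T) + \<lceil>real (domination_number T) / real k\<rceil> - 1)
     \<and> (\<forall>n \<ge> 1. \<exists>T :: (nat, nat \<times> nat) pre_digraph. undirected_tree T \<and>
        domination_number T = n \<and>
        int (quasiperfect_domination_number k T)
          = int (domination_number T) + \<lceil>real (domination_number T) / real k\<rceil> - 1)"
proof (intro conjI allI impI)
  fix T :: "('a, 'b) pre_digraph"
  assume "undirected_tree T"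
  then show "int (quasiperfect_domination_number k T)
    \<le> int (domination_number T) + \<lceil>real (domination_number T) / real k\<rceil> - 1"
    using assms by (rule tree_quasiperfect_domination_number_le)
next
  fix n :: nat
  assume n: "n \<ge> 1"
  let ?T = "extremal_tree k n"
  have tree: "undirected_tree ?T" using n by (rule undirected_tree_extremal_tree)
  have dom: "domination_number ?T = n" using n by (rule domination_number_extremal_tree)
  have "int n + \<lceil>real n / real k\<rceil> - 1 \<le> int (quasiperfect_domination_number k ?T)"
    using quasiperfect_domination_number_extremal_tree_ge[OF assms n] ceiling_divide_nat_eq[OF assms n]
    by simp
  with tree dom tree_quasiperfect_domination_number_le[OF tree assms]
  have "undirected_tree ?T \<and> domination_number ?T = n \<and> int (quasiperfect_domination_number k ?T)
      = int (domination_number ?T) + \<lceil>real (domination_number ?T) / real k\<rceil> - 1"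
    by simp
  then show "\<exists>T :: (nat, nat \<times> nat) pre_digraph. undirected_tree T \<and> domination_number T = n \<and>
      int (quasiperfect_domination_number k T)
        = int (domination_number T) + \<lceil>real (domination_number T) / real k\<rceil> - 1"
    by blast
qed

end
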